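(* Let $k\ge 1$ and let $G$ be a connected graph. Then $G$ is well-hued with sequence $(2,4,6,\dots,2k)$ and chromatic number $k$ if and only if $G$ is (isomorphic to) a spanning subgraph of the complete $k$-partite graph $K_{2,\dots,2}$ (with $k$ parts of size $2$) such that for every $u\in V(G)$, the graph induced by $V(G)-N_G[u]$ is $\overline{K_2}$-free, i.e. contains no two distinct non-adjacent vertices.
   Context: All graphs are finite and simple. For $k\ge 1$, a maximal $k$-colorable subgraph of $G$ is a subgraph induced by a set $S\subseteq V(G)$ such that $G[S]$ is (properly) $k$-colorable and $G[S']$ is not $k$-colorable for every $S'$ with $S\subsetneq S'\subseteq V(G)$. $G$ is well-hued if for every $k\ge 1$ all maximal $k$-colorable subgraphs of $G$ have the same order, denoted $a_k$. The sequence of a well-hued graph $G$ is written $(a_1,a_2,\dots,a_{\chi(G)})$, where $a_{\chi(G)}=|V(G)|$ (and $a_j=|V(G)|$ for all $j\ge\chi(G)$). $N_G[u]$ denotes the closed neighborhood of $u$. *)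

theory Defs
  imports "Graph_Theory.Graph_Theory"
begin

text \<open>
  Finite simple graphs are the members of the locale \<^locale>\<open>graph\<close>: finite, symmetric, loop-free
  digraphs without parallel arcs. An edge is thus a pair of opposite arcs.
\<close>

definition proper_coloring :: "nat \<Rightarrow> ('a, 'b) pre_digraph \<Rightarrow> ('a \<Rightarrow> nat) \<Rightarrow> bool" where
  "proper_coloring k G c \<longleftrightarrow>
     (\<forall>v \<in> verts G. c v < k) \<and> (\<forall>u v. u \<rightarrow>\<^bsub>G\<^esub> v \<longrightarrow> c u \<noteq> c v)"

definition colorable :: "nat \<Rightarrow> ('a, 'b) pre_digraph \<Rightarrow> bool" where
  "colorable k G \<longleftrightarrow> (\<exists>c. proper_coloring k G c)"

definition chromatic_number :: "('a, 'b) pre_digraph \<Rightarrow> nat" where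
  "chromatic_number G = (LEAST k. colorable k G)"

definition max_colorable_subgraph ::
    "nat \<Rightarrow> ('a, 'b) pre_digraph \<Rightarrow> ('a, 'b) pre_digraph \<Rightarrow> bool" where
  "max_colorable_subgraph k H G \<longleftrightarrow>
     (\<exists>S \<subseteq> verts G. H = G \<restriction> S \<and> colorable k (G \<restriction> S) \<and>
        (\<forall>S'. S \<subset> S' \<and> S' \<subseteq> verts G \<longrightarrow> \<not> colorable k (G \<restriction> S')))"

definition well_hued :: "('a, 'b) pre_digraph \<Rightarrow> bool" where
  "well_hued G \<longleftrightarrow>
     (\<forall>k \<ge> 1. \<forall>H H'. max_colorable_subgraph k H G \<and> max_colorable_subgraph k H' G \<longrightarrow>
        card (verts H) = card (verts H'))"

text \<open>
  The common order of the maximal \<open>k\<close>-colorable subgraphs. It is only meaningful for well-hued graphs, where the description is unique;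
  a maximal \<open>k\<close>-colorable subgraph always exists in a finite graph.
\<close>
definition hue_number :: "('a, 'b) pre_digraph \<Rightarrow> nat \<Rightarrow> nat" where
  "hue_number G k = (THE n. \<exists>H. max_colorable_subgraph k H G \<and> card (verts H) = n)"

definition hue_sequence :: "('a, 'b) pre_digraph \<Rightarrow> nat list" where
  "hue_sequence G = map (hue_number G) [1..<Suc (chromatic_number G)]"

text \<open>
  The vertices of the complete multipartite graph with part sizes \<open>ns\<close> are pairs \<open>(i, j)\<close>:
  the \<open>j\<close>-th vertex of the \<open>i\<close>-th part.
\<close>
definition complete_multipartite :: "nat list \<Rightarrow> (nat \<times> nat) pair_pre_digraph" where
  "complete_multipartite ns =
     (let V = (SIGMA i:{..<length ns}. {..<ns ! i})
      in \<lparr> pverts = V, parcs = {(x, y). x \<in> V \<and> y \<in> V \<and> fst x \<noteq> fst y} \<rparr>)"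

definition closed_neighborhood :: "('a, 'b) pre_digraph \<Rightarrow> 'a \<Rightarrow> 'a set" where
  "closed_neighborhood G u = insert u {v. u \<rightarrow>\<^bsub>G\<^esub> v}"

definition co_K2_free :: "('a, 'b) pre_digraph \<Rightarrow> bool" where
  "co_K2_free G \<longleftrightarrow>
     \<not> (\<exists>u \<in> verts G. \<exists>v \<in> verts G. u \<noteq> v \<and> \<not> u \<rightarrow>\<^bsub>G\<^esub> v)"

end

theory Submission
  imports Defs
begin

text \<open>
  Both sides say that \<open>G\<close> has a \<open>k\<close>-coloring with all classes of size 2 and no independent set of
  size 3. Given this, the classes define a perfect matching \<open>\<sigma>\<close> of the complement. Let \<open>S\<close> be a
  maximal \<open>j\<close>-colorable set other than \<open>V(G)\<close>, colored so that as many pairs \<open>{v, \<sigma> v}\<close> as possible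
  are monochromatic. No class is empty, by maximality of \<open>S\<close>; and a class \<open>{v}\<close> could take in \<open>\<sigma> v\<close>,
  which either enlarges \<open>S\<close> or, if \<open>\<sigma> v \<in> S\<close>, creates a new monochromatic pair and destroys none.
  Hence all classes have size 2.
\<close>

section \<open>Maximal colorable sets of vertices\<close>

text \<open>Vertex-set form of \<open>max_colorable_subgraph\<close>: an induced subgraph is
  determined by its vertices, so enlarging and counting can be done on sets.\<close>

definition maximal_colorable_set :: "nat \<Rightarrow> ('a, 'b) pre_digraph \<Rightarrow> 'a set \<Rightarrow> bool" where
  "maximal_colorable_set k G S \<longleftrightarrow> S \<subseteq> verts G \<and> colorable k (G \<restriction> S) \<and>
     (\<forall>S'. S \<subset> S' \<and> S' \<subseteq> verts G \<longrightarrow> \<not> colorable k (G \<restriction> S'))"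

definition independent_set :: "('a, 'b) pre_digraph \<Rightarrow> 'a set \<Rightarrow> bool" where
  "independent_set G S \<longleftrightarrow> S \<subseteq> verts G \<and> (\<forall>u \<in> S. \<forall>v \<in> S. \<not> u \<rightarrow>\<^bsub>G\<^esub> v)"

lemma card_eq_sum_fibres:
  assumes "finite S" "\<And>v. v \<in> S \<Longrightarrow> c v < (k::nat)"
  shows "card S = (\<Sum>i<k. card {v \<in> S. c v = i})"
proof -
  have "(\<Sum>i<k. \<Sum>v | v \<in> S \<and> c v = i. 1) = (\<Sum>v\<in>S. 1::nat)"
    using assms by (intro sum.group) auto
  then show ?thesis by simp
qed

lemma max_colorable_subgraph_iff:
  "max_colorable_subgraph k H G \<longleftrightarrow> (\<exists>S. maximal_colorable_set k G S \<and> H = G \<restriction> S)"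
  by (auto simp: max_colorable_subgraph_def maximal_colorable_set_def)

lemma well_hued_iff:
  "well_hued G \<longleftrightarrow> (\<forall>k\<ge>1. \<forall>S T. maximal_colorable_set k G S \<and> maximal_colorable_set k G T \<longrightarrow>
     card S = card T)"
proof -
  have "(\<forall>H H'. max_colorable_subgraph k H G \<and> max_colorable_subgraph k H' G \<longrightarrow>
      card (verts H) = card (verts H'))
    \<longleftrightarrow> (\<forall>S T. maximal_colorable_set k G S \<and> maximal_colorable_set k G T \<longrightarrow>
      card S = card T)" (is "?L \<longleftrightarrow> ?R") for k
  proof
    assume ?L
    show ?R
    proof (intro allI impI)
      fix S T assume "maximal_colorable_set k G S \<and> maximal_colorable_set k G T"
      then have "max_colorable_subgraph k (G \<restriction> S) G \<and> max_colorable_subgraph k (G \<restriction> T) G"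
        unfolding max_colorable_subgraph_iff by blast
      with \<open>?L\<close> have "card (verts (G \<restriction> S)) = card (verts (G \<restriction> T))" by blast
      then show "card S = card T" by simp
    qed
  next
    assume ?R
    show ?L
    proof (intro allI impI)
      fix H H' assume "max_colorable_subgraph k H G \<and> max_colorable_subgraph k H' G"
      then obtain S T where "maximal_colorable_set k G S" "H = G \<restriction> S"
        "maximal_colorable_set k G T" "H' = G \<restriction> T"
        unfolding max_colorable_subgraph_iff by blast
      moreover from this have "card S = card T" using \<open>?R\<close> by blast
      ultimately show "card (verts H) = card (verts H')" by simp
    qed
  qed
  then show ?thesis unfolding well_hued_def by (simp only:)
qed

lemma dominates_induce_subgraph_iff:
  "u \<rightarrow>\<^bsub>G \<restriction> S\<^esub> v \<longleftrightarrow> u \<in> S \<and> v \<in> S \<and> u \<rightarrow>\<^bsub>G\<^esub> v"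
  by (auto simp: arcs_ends_conv)

lemma proper_coloring_induce_subgraph_iff:
  "proper_coloring k (G \<restriction> S) c \<longleftrightarrow>
     (\<forall>v\<in>S. c v < k) \<and> (\<forall>u\<in>S. \<forall>v\<in>S. u \<rightarrow>\<^bsub>G\<^esub> v \<longrightarrow> c u \<noteq> c v)"
  by (auto simp: proper_coloring_def dominates_induce_subgraph_iff)

lemma colorable_mono:
  assumes "colorable j G" "j \<le> k"
  shows "colorable k G"
  using assms unfolding colorable_def proper_coloring_def by (meson less_le_trans)

lemma (in wf_digraph) colorable_induce_verts: "colorable k (G \<restriction> verts G) \<longleftrightarrow> colorable k G"
proof -
  have "G \<restriction> verts G = G" by (intro pre_digraph.equality) auto
  then show ?thesis by simp
qed

text \<open>The colorable vertex sets form a finite family, so a maximal member lies above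
  \<open>T\<close>. Besides existence, this serves to put an independent set inside a maximal
  1-colorable set.\<close>

lemma (in fin_digraph) colorable_extends_to_maximal:
  assumes "T \<subseteq> verts G" "colorable k (G \<restriction> T)"
  obtains S where "T \<subseteq> S" "maximal_colorable_set k G S"
proof -
  let ?A = "{S. S \<subseteq> verts G \<and> colorable k (G \<restriction> S)}"
  have "finite ?A" by simp
  moreover have "T \<in> ?A" using assms by simp
  ultimately obtain S where "S \<in> ?A" "T \<subseteq> S" "\<forall>S'\<in>?A. S \<subseteq> S' \<longrightarrow> S = S'"
    using finite_has_maximal2[of ?A T] by blast
  then have "maximal_colorable_set k G S" by (auto simp: maximal_colorable_set_def)
  with \<open>T \<subseteq> S\<close> show ?thesis by (rule that)
qed

lemma (in fin_digraph) ex_maximal_colorable_set: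
  obtains S where "maximal_colorable_set k G S"
proof -
  have "colorable k (G \<restriction> {})"
    by (auto simp: colorable_def proper_coloring_induce_subgraph_iff)
  then show ?thesis using colorable_extends_to_maximal that by (metis empty_subsetI)
qed

section \<open>Hue numbers and the chromatic number\<close>

text \<open>A maximal \<open>k\<close>-colorable set always exists, so a common order of all such
  sets is the unique value meant by the \<open>THE\<close> in \<open>hue_number\<close>.\<close>

lemma (in fin_digraph) hue_number_eqI:
  assumes "\<And>S. maximal_colorable_set k G S \<Longrightarrow> card S = n"
  shows "hue_number G k = n"
proof -
  obtain S where "maximal_colorable_set k G S" by (rule ex_maximal_colorable_set)
  with assms have "\<exists>H. max_colorable_subgraph k H G \<and> card (verts H) = n"
    unfolding max_colorable_subgraph_iff by (metis induce_subgraph_verts)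
  moreover have "card (verts H) = n" if "max_colorable_subgraph k H G" for H
    using that assms by (auto simp: max_colorable_subgraph_iff)
  ultimately show ?thesis unfolding hue_number_def by blast
qed

lemma (in fin_digraph) well_hued_card_eq_hue_number:
  assumes "well_hued G" "k \<ge> 1" "maximal_colorable_set k G S"
  shows "card S = hue_number G k"
proof (rule hue_number_eqI[symmetric])
  fix T assume "maximal_colorable_set k G T"
  then show "card T = card S" using assms unfolding well_hued_iff by blast
qed

text \<open>An injective numbering of the vertices is proper because there are no loops. Hence the
  \<open>LEAST\<close> in \<open>chromatic_number\<close> is attained.\<close>

lemma (in digraph) colorable_card_verts: "colorable (card (verts G)) G"
proof -
  obtain c where c: "bij_betw c (verts G) {0..<card (verts G)}"
    using ex_bij_betw_finite_nat[OF finite_verts] by blast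
  have "c u \<noteq> c v" if "u \<rightarrow>\<^bsub>G\<^esub> v" for u v
    using that c adj_in_verts[OF that] adj_not_same by (auto simp: bij_betw_def dest: inj_onD)
  moreover have "c v < card (verts G)" if "v \<in> verts G" for v
    using c that by (auto simp: bij_betw_def)
  ultimately show ?thesis by (auto simp: colorable_def proper_coloring_def)
qed

lemma (in digraph) colorable_chromatic_number: "colorable (chromatic_number G) G"
  unfolding chromatic_number_def using colorable_card_verts
  by (rule LeastI[of "\<lambda>k. colorable k G"])

section \<open>Bounds on the order of a maximal colorable set\<close>

text \<open>Each of the \<open>j\<close> color classes is an independent set, hence has at most
  \<open>m\<close> elements.\<close>

lemma card_le_if_proper_coloring:
  assumes "finite S" "S \<subseteq> verts G" "proper_coloring j (G \<restriction> S) d"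
    and indep: "\<And>T. independent_set G T \<Longrightarrow> card T \<le> m"
  shows "card S \<le> m * j"
proof -
  have "card S = (\<Sum>i<j. card {v \<in> S. d v = i})"
    using assms by (intro card_eq_sum_fibres) (auto simp: proper_coloring_induce_subgraph_iff)
  also have "\<dots> \<le> (\<Sum>i<j. m)"
  proof (intro sum_mono indep)
    fix i
    show "independent_set G {v \<in> S. d v = i}"
      using assms(2,3) unfolding independent_set_def proper_coloring_induce_subgraph_iff by blast
  qed
  finally show ?thesis by (simp add: mult.commute)
qed

text \<open>The perfect matching of the complement is encoded as a fixed-point-free involution
  \<open>\<sigma>\<close> along non-edges. An extremal coloring of \<open>S\<close> has at least two
  vertices in every class.\<close>

lemma (in graph) card_maximal_colorable_set_ge:
  assumes \<sigma>: "\<And>v. v \<in> verts G \<Longrightarrow> \<sigma> v \<in> verts G \<and> \<sigma> v \<noteq> v \<and> \<sigma> (\<sigma> v) = v \<and> \<not> v \<rightarrow>\<^bsub>G\<^esub> \<sigma> v"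
    and S: "maximal_colorable_set j G S" "S \<noteq> verts G"
  shows "2 * j \<le> card S"
proof -
  \<comment> \<open>The quantity to be maximized. It holds both ends of each monochromatic pair, so
    its size is twice the number of such pairs.\<close>
  define agree where "agree d = {v \<in> S. \<sigma> v \<in> S \<and> d v = d (\<sigma> v)}" for d :: "'a \<Rightarrow> nat"
  have sub: "S \<subseteq> verts G" using S by (simp add: maximal_colorable_set_def)
  then have fin: "finite S" by (rule finite_subset) simp
  then have fin_agree: "finite (agree d)" for d by (simp add: agree_def)
  have no_ext: "\<not> proper_coloring j (G \<restriction> insert x S) e" if "x \<in> verts G" "x \<notin> S" for x e
    using S(1) sub that by (auto simp: maximal_colorable_set_def colorable_def)
  have sym: "v \<rightarrow>\<^bsub>G\<^esub> u" if "u \<rightarrow>\<^bsub>G\<^esub> v" for u v using that by (rule graph_symmetric)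
  have irrefl: "\<not> u \<rightarrow>\<^bsub>G\<^esub> u" for u using adj_not_same by blast
  obtain d0 where "proper_coloring j (G \<restriction> S) d0"
    using S by (auto simp: maximal_colorable_set_def colorable_def)
  moreover have "\<forall>d. proper_coloring j (G \<restriction> S) d \<longrightarrow> card (agree d) < Suc (card S)"
    using fin by (auto simp: agree_def less_Suc_eq_le intro: card_mono)
  ultimately obtain d where d: "proper_coloring j (G \<restriction> S) d"
    and max: "\<And>e. proper_coloring j (G \<restriction> S) e \<Longrightarrow> card (agree e) \<le> card (agree d)"
    using ex_has_greatest_nat[of "proper_coloring j (G \<restriction> S)" d0 "\<lambda>d. card (agree d)"] by blast
  have "2 \<le> card {v \<in> S. d v = i}" if "i < j" for i
  proof (rule ccontr)
    assume "\<not> ?thesis"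
    then have "card {v \<in> S. d v = i} = 0 \<or> card {v \<in> S. d v = i} = 1" by linarith
    then consider "{v \<in> S. d v = i} = {}" | v where "{v \<in> S. d v = i} = {v}"
      using fin by (auto simp: card_1_singleton_iff)
    then show False
    proof cases
      case 1
      obtain x where "x \<in> verts G" "x \<notin> S" using S sub by blast
      moreover have "proper_coloring j (G \<restriction> insert x S) (d(x := i))"
        using d 1 \<open>x \<notin> S\<close> \<open>i < j\<close> irrefl by (auto simp: proper_coloring_induce_subgraph_iff)
      ultimately show False using no_ext by blast
    next
      case (2 v)
      define w where "w = \<sigma> v"
      have v: "v \<in> S" "d v = i" and only: "\<And>u. u \<in> S \<Longrightarrow> d u = i \<Longrightarrow> u = v"
        using 2 by blast+
      have w: "w \<in> verts G" "w \<noteq> v" "\<sigma> w = v" "\<not> v \<rightarrow>\<^bsub>G\<^esub> w"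
        using \<sigma>[of v] v sub by (auto simp: w_def)
      let ?e = "d(w := i)"
      \<comment> \<open>The only other vertex colored \<open>i\<close> is \<open>v\<close>, which is
        not adjacent to \<open>w\<close>. Stated for \<open>insert w S\<close>, this covers both
        cases: if \<open>w \<in> S\<close>, the set is \<open>S\<close> itself.\<close>
      have proper: "proper_coloring j (G \<restriction> insert w S) ?e"
        using d only w \<open>i < j\<close> irrefl sym unfolding proper_coloring_induce_subgraph_iff
        by (auto; metis)
      show False
      proof (cases "w \<in> S")
        case False
        with no_ext w proper show False by blast
      next
        case True
        then have "proper_coloring j (G \<restriction> S) ?e" using proper by (simp add: insert_absorb)
        then have "card (agree ?e) \<le> card (agree d)" by (rule max)
        \<comment> \<open>Only the color of \<open>w\<close> changes, and the partner of
          \<open>w\<close> is \<open>v\<close>. This pair was not monochromatic under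
          \<open>d\<close>, since \<open>v\<close> was alone in its class; every other pair keeps
          its colors.\<close>
        moreover have "agree d \<subset> agree ?e"
        proof -
          have "v \<notin> agree d" using only[of w] w True v by (auto simp: agree_def simp flip: w_def)
          moreover have "v \<in> agree ?e" using w True v by (auto simp: agree_def simp flip: w_def)
          moreover have "x \<in> agree ?e" if x: "x \<in> agree d" for x
          proof -
            have "x \<noteq> w" using x w v only[of w] True by (auto simp: agree_def)
            moreover have "\<sigma> x \<noteq> w"
              using x \<open>v \<notin> agree d\<close> \<sigma>[of x] w sub by (auto simp: agree_def)
            ultimately show ?thesis using x by (auto simp: agree_def)
          qed
          ultimately show ?thesis by blast
        qed
        then have "card (agree d) < card (agree ?e)" by (rule psubset_card_mono[OF fin_agree])
        ultimately show False by simp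
      qed
    qed
  qed
  then have "(\<Sum>i<j. 2) \<le> (\<Sum>i<j. card {v \<in> S. d v = i})" by (intro sum_mono) auto
  also have "\<dots> = card S"
    using d fin by (intro card_eq_sum_fibres[symmetric]) (auto simp: proper_coloring_induce_subgraph_iff)
  finally show ?thesis by (simp add: mult.commute)
qed

section \<open>Colorings with all classes of size two\<close>

definition pair_coloring :: "nat \<Rightarrow> ('a, 'b) pre_digraph \<Rightarrow> ('a \<Rightarrow> nat) \<Rightarrow> bool" where
  "pair_coloring k G c \<longleftrightarrow> proper_coloring k G c \<and> (\<forall>i<k. card {v \<in> verts G. c v = i} = 2)"

text \<open>Each vertex is sent to the only other vertex of its color class; uniqueness makes this
  an involution, and properness makes the two non-adjacent.\<close>

lemma pair_coloring_matching:
  assumes c: "pair_coloring k G c"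
  obtains \<sigma> where
    "\<And>v. v \<in> verts G \<Longrightarrow> \<sigma> v \<in> verts G \<and> \<sigma> v \<noteq> v \<and> \<sigma> (\<sigma> v) = v \<and> \<not> v \<rightarrow>\<^bsub>G\<^esub> \<sigma> v"
proof -
  have ex1: "\<exists>!w. w \<in> verts G \<and> w \<noteq> v \<and> c w = c v" if "v \<in> verts G" for v
  proof -
    have "card {w \<in> verts G. c w = c v} = 2"
      using c that by (auto simp: pair_coloring_def proper_coloring_def)
    then obtain x y where xy: "{w \<in> verts G. c w = c v} = {x, y}" "x \<noteq> y"
      by (auto simp: card_2_iff)
    have mem: "w \<in> verts G \<and> c w = c v \<longleftrightarrow> w = x \<or> w = y" for w using xy by blast
    then have "v = x \<or> v = y" using that by blast
    then show ?thesis using mem xy(2) by metis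
  qed
  define \<sigma> where "\<sigma> v = (THE w. w \<in> verts G \<and> w \<noteq> v \<and> c w = c v)" for v
  have \<sigma>: "\<sigma> v \<in> verts G \<and> \<sigma> v \<noteq> v \<and> c (\<sigma> v) = c v" if "v \<in> verts G" for v
    unfolding \<sigma>_def by (rule theI'[OF ex1[OF that]])
  have "\<sigma> (\<sigma> v) = v" if "v \<in> verts G" for v
    using ex1[of "\<sigma> v"] \<sigma>[of v] \<sigma>[of "\<sigma> v"] that by metis
  moreover have "\<not> v \<rightarrow>\<^bsub>G\<^esub> \<sigma> v" if "v \<in> verts G" for v
    using c \<sigma>[OF that] by (metis pair_coloring_def proper_coloring_def)
  ultimately show ?thesis using \<sigma> that by blast
qed

lemma (in fin_digraph) pair_coloring_card_verts:
  assumes "pair_coloring k G c"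
  shows "card (verts G) = 2 * k"
proof -
  have "card (verts G) = (\<Sum>i<k. card {v \<in> verts G. c v = i})"
    using assms by (intro card_eq_sum_fibres) (auto simp: pair_coloring_def proper_coloring_def)
  also have "\<dots> = (\<Sum>i<k. 2)"
    using assms by (intro sum.cong) (auto simp: pair_coloring_def)
  finally show ?thesis by simp
qed

text \<open>The bound on independent sets gives at most \<open>2 * j\<close> vertices, the matching
  at least \<open>2 * j\<close> unless \<open>S\<close> is everything. The minimum accounts for
  \<open>j \<ge> k\<close>, where \<open>S\<close> has all \<open>2 * k\<close> vertices.\<close>

lemma (in graph) card_maximal_colorable_set:
  assumes c: "pair_coloring k G c"
    and indep: "\<And>T. independent_set G T \<Longrightarrow> card T \<le> 2"
    and S: "maximal_colorable_set j G S"
  shows "card S = 2 * min j k"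
proof -
  have sub: "S \<subseteq> verts G" using S by (simp add: maximal_colorable_set_def)
  then have fin: "finite S" by (rule finite_subset) simp
  obtain d where "proper_coloring j (G \<restriction> S) d"
    using S by (auto simp: maximal_colorable_set_def colorable_def)
  then have le: "card S \<le> 2 * j"
    using card_le_if_proper_coloring fin sub indep by blast
  show ?thesis
  proof (cases "S = verts G")
    case True
    \<comment> \<open>Here \<open>le\<close> says \<open>2 * k \<le> 2 * j\<close>, so the minimum
      is \<open>k\<close>.\<close>
    then show ?thesis using le pair_coloring_card_verts[OF c] by simp
  next
    case False
    then have "\<not> colorable j (G \<restriction> verts G)"
      using S sub by (auto simp: maximal_colorable_set_def)
    moreover have "colorable k G" using c by (auto simp: pair_coloring_def colorable_def)
    ultimately have "j < k" using colorable_mono colorable_induce_verts by (meson not_le)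
    obtain \<sigma> where "\<And>v. v \<in> verts G \<Longrightarrow>
        \<sigma> v \<in> verts G \<and> \<sigma> v \<noteq> v \<and> \<sigma> (\<sigma> v) = v \<and> \<not> v \<rightarrow>\<^bsub>G\<^esub> \<sigma> v"
      using pair_coloring_matching[OF c] by blast
    then have "2 * j \<le> card S" using S False by (rule card_maximal_colorable_set_ge)
    with le \<open>j < k\<close> show ?thesis by simp
  qed
qed

text \<open>If \<open>G\<close> is \<open>j\<close>-colorable, its whole vertex set is a maximal
  \<open>j\<close>-colorable set, and \<open>2 * k = 2 * min j k\<close> forces
  \<open>k \<le> j\<close>.\<close>

lemma (in graph) chromatic_number_pair_coloring:
  assumes c: "pair_coloring k G c"
    and indep: "\<And>T. independent_set G T \<Longrightarrow> card T \<le> 2"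
  shows "chromatic_number G = k"
  unfolding chromatic_number_def
proof (rule Least_equality)
  show "colorable k G" using c by (auto simp: pair_coloring_def colorable_def)
next
  fix j assume "colorable j G"
  then have "maximal_colorable_set j G (verts G)"
    by (auto simp: maximal_colorable_set_def colorable_induce_verts)
  then have "card (verts G) = 2 * min j k"
    using card_maximal_colorable_set[OF c] indep by blast
  then show "k \<le> j" using pair_coloring_card_verts[OF c] by simp
qed

text \<open>From left to right only the first and last terms of the sequence matter: the first
  bounds independent sets by 2, the last gives \<open>2 * k\<close> vertices. From right to left all
  terms come from \<open>card_maximal_colorable_set\<close>.\<close>

lemma (in graph) well_hued_iff_pair_coloring:
  assumes "k \<ge> 1"
  shows "well_hued G \<and> hue_sequence G = map (\<lambda>j. 2 * j) [1..<Suc k] \<and> chromatic_number G = k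
    \<longleftrightarrow> (\<exists>c. pair_coloring k G c) \<and> (\<forall>T. independent_set G T \<longrightarrow> card T \<le> 2)"
    (is "?L \<longleftrightarrow> ?R")
proof
  assume L: ?L
  \<comment> \<open>With \<open>chromatic_number G = k\<close> both lists run over the same indices,
    so they agree entry by entry.\<close>
  then have hue: "hue_number G j = 2 * j" if "1 \<le> j" "j \<le> k" for j
    using that unfolding hue_sequence_def by (auto simp del: upt_Suc)
  have indep: "card T \<le> 2" if T: "independent_set G T" for T
  proof -
    have "T \<subseteq> verts G" "colorable 1 (G \<restriction> T)"
      using T by (auto simp: independent_set_def colorable_def proper_coloring_induce_subgraph_iff)
    then obtain S where S: "T \<subseteq> S" "maximal_colorable_set 1 G S"
      by (rule colorable_extends_to_maximal)
    then have "card S = 2" using well_hued_card_eq_hue_number[of 1 S] L hue assms by simp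
    then show ?thesis using S card_mono[of S T] by (simp add: card_ge_0_finite)
  qed
  have col: "colorable k G" using L colorable_chromatic_number by simp
  then have "maximal_colorable_set k G (verts G)"
    by (auto simp: maximal_colorable_set_def colorable_induce_verts)
  then have card_V: "card (verts G) = 2 * k"
    using well_hued_card_eq_hue_number[of k "verts G"] L hue assms by simp
  obtain c where c: "proper_coloring k G c" using col by (auto simp: colorable_def)
  have le: "card {v \<in> verts G. c v = i} \<le> 2" for i
  proof (rule indep)
    show "independent_set G {v \<in> verts G. c v = i}"
      using c unfolding independent_set_def proper_coloring_def by blast
  qed
  have "(\<Sum>i<k. card {v \<in> verts G. c v = i}) = card (verts G)"
    using c by (intro card_eq_sum_fibres[symmetric]) (auto simp: proper_coloring_def)
  also have "\<dots> = (\<Sum>i<k. 2)" using card_V by simp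
  finally have eq: "(\<Sum>i<k. card {v \<in> verts G. c v = i}) = (\<Sum>i<k. 2)" .
  \<comment> \<open>The \<open>k\<close> classes have at most two vertices each and
    \<open>2 * k\<close> in total, so no class can fall short.\<close>
  have "card {v \<in> verts G. c v = i} = 2" if "i < k" for i
    using sum_mono_inv[OF eq] le that by auto
  with c indep show ?R by (auto simp: pair_coloring_def)
next
  assume ?R
  then obtain c where c: "pair_coloring k G c"
    and indep: "\<And>T. independent_set G T \<Longrightarrow> card T \<le> 2" by blast
  note card = card_maximal_colorable_set[OF c indep]
  have chi: "chromatic_number G = k" using c indep by (rule chromatic_number_pair_coloring)
  have "hue_number G j = 2 * j" if "j \<le> k" for j
    using hue_number_eqI[of j] card that by simp
  with chi have "hue_sequence G = map (\<lambda>j. 2 * j) [1..<Suc k]"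
    by (auto simp: hue_sequence_def simp del: upt_Suc)
  moreover have "well_hued G" unfolding well_hued_iff using card by auto
  ultimately show ?L using chi by blast
qed

section \<open>The structural side in terms of independent sets and pair colorings\<close>

text \<open>Two distinct non-adjacent vertices outside the closed neighborhood of \<open>u\<close>
  are exactly what completes \<open>u\<close> to an independent set of size 3.\<close>

lemma (in graph) co_K2_free_iff_independent_sets:
  "(\<forall>u \<in> verts G. co_K2_free (G \<restriction> (verts G - closed_neighborhood G u)))
    \<longleftrightarrow> (\<forall>T. independent_set G T \<longrightarrow> card T \<le> 2)" (is "?L \<longleftrightarrow> ?R")
proof
  assume L: ?L
  show ?R
  proof (intro allI impI, rule ccontr)
    fix T assume T: "independent_set G T" and "\<not> card T \<le> 2"
    then obtain U where "U \<subseteq> T" "card U = 3"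
      using obtain_subset_with_card_n[of 3 T] by auto
    then obtain u x y where "u \<in> T" "x \<in> T" "y \<in> T" "u \<noteq> x" "x \<noteq> y" "u \<noteq> y"
      by (auto simp: card_3_iff)
    moreover from this have "x \<in> verts G - closed_neighborhood G u"
      "y \<in> verts G - closed_neighborhood G u" "u \<in> verts G" "\<not> x \<rightarrow>\<^bsub>G\<^esub> y"
      using T unfolding independent_set_def closed_neighborhood_def by blast+
    ultimately show False using L
      unfolding co_K2_free_def dominates_induce_subgraph_iff induce_subgraph_verts by blast
  qed
next
  assume R: ?R
  show ?L unfolding co_K2_free_def
  proof (intro ballI notI, elim bexE conjE)
    fix u x y
    let ?W = "verts G - closed_neighborhood G u"
    assume u: "u \<in> verts G" and xy: "x \<in> verts (G \<restriction> ?W)" "y \<in> verts (G \<restriction> ?W)" "x \<noteq> y"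
      "\<not> x \<rightarrow>\<^bsub>G \<restriction> ?W\<^esub> y"
    have "independent_set G {u, x, y}"
      using u xy graph_symmetric adj_not_same
      unfolding independent_set_def dominates_induce_subgraph_iff closed_neighborhood_def by auto
    moreover have "card {u, x, y} = 3"
      using xy by (auto simp: closed_neighborhood_def)
    ultimately show False using R by fastforce
  qed
qed

text \<open>The parts of the multipartite graph pull back to color classes under an isomorphism.
  Conversely, a color and a numbering inside each class give every vertex its coordinates.\<close>

lemma (in digraph) spanning_complete_multipartite_iff:
  "(\<exists>H. spanning H (with_proj (complete_multipartite (replicate k 2))) \<and> digraph_iso G H)
    \<longleftrightarrow> (\<exists>c. pair_coloring k G c)" (is "?L \<longleftrightarrow> ?R")
proof -
  let ?K = "complete_multipartite (replicate k 2)"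
  have V: "pverts ?K = {..<k} \<times> {..<2}"
    by (auto simp: complete_multipartite_def Let_def)
  have A: "parcs ?K = {(x, y). x \<in> {..<k} \<times> {..<2} \<and> y \<in> {..<k} \<times> {..<2} \<and> fst x \<noteq> fst y}"
    by (auto simp: complete_multipartite_def Let_def)
  show ?thesis
  proof
    assume ?L
    then obtain f where f: "digraph_isomorphism f" and span: "spanning (app_iso f G) (with_proj ?K)"
      by (auto simp: digraph_iso_def)
    let ?f = "iso_verts f"
    have img: "?f ` verts G = {..<k} \<times> {..<2}" using span V by (simp add: spanning_def)
    \<comment> \<open>Compatibility with \<open>with_proj ?K\<close> makes the ends of an image arc
      the two components of a pair, so membership in \<open>parcs ?K\<close> says that they lie in
      different parts.\<close>
    have arcs: "iso_arcs f ` arcs G \<subseteq> parcs ?K"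
      and ends: "iso_tail f = fst" "iso_head f = snd"
      using span by (auto simp: spanning_def subgraph_def compatible_def)
    have inj: "inj_on ?f (verts G)" using f by (rule digraph_isomorphism_inj_on_verts)
    let ?c = "fst \<circ> ?f"
    have "?c u \<noteq> ?c v" if uv: "u \<rightarrow>\<^bsub>G\<^esub> v" for u v
    proof -
      obtain e where e: "e \<in> arcs G" "tail G e = u" "head G e = v"
        using uv by (rule reachableE)
      have "?f u = fst (iso_arcs f e)" "?f v = snd (iso_arcs f e)"
        using iso_verts_tail[OF f e(1)] iso_verts_head[OF f e(1)] e ends by auto
      moreover have "iso_arcs f e \<in> parcs ?K" using arcs e by blast
      ultimately show ?thesis by (auto simp: A)
    qed
    moreover have "?c v < k" if "v \<in> verts G" for v
      using imageI[OF that, of ?f] unfolding img by auto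
    moreover have "card {v \<in> verts G. ?c v = i} = 2" if "i < k" for i
    proof -
      have "?f ` {v \<in> verts G. ?c v = i} = {p \<in> ?f ` verts G. fst p = i}" by auto
      also have "\<dots> = {i} \<times> {..<2}" using img that by auto
      finally have "card (?f ` {v \<in> verts G. ?c v = i}) = 2" by simp
      moreover have "inj_on ?f {v \<in> verts G. ?c v = i}" by (rule inj_on_subset[OF inj]) auto
      ultimately show ?thesis by (simp add: card_image)
    qed
    ultimately have "pair_coloring k G ?c" by (simp add: pair_coloring_def proper_coloring_def)
    then show ?R by blast
  next
    assume ?R
    then obtain c where c: "proper_coloring k G c"
      and two: "\<And>i. i < k \<Longrightarrow> card {v \<in> verts G. c v = i} = 2" by (auto simp: pair_coloring_def)
    \<comment> \<open>For each color, \<open>g i\<close> numbers the two vertices of the class by 0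
      and 1, which supplies the second coordinate of \<open>f\<close>.\<close>
    have "\<forall>i. \<exists>g. i < k \<longrightarrow> bij_betw g {v \<in> verts G. c v = i} {..<2::nat}"
      using two by (auto intro!: finite_same_card_bij)
    then obtain g where g: "\<And>i. i < k \<Longrightarrow> bij_betw (g i) {v \<in> verts G. c v = i} {..<2::nat}"
      by metis
    have c_less: "c v < k" if "v \<in> verts G" for v using c that by (simp add: proper_coloring_def)
    define f where "f v = (c v, g (c v) v)" for v
    have inj: "inj_on f (verts G)"
    proof (rule inj_onI)
      fix u v assume "u \<in> verts G" "v \<in> verts G" "f u = f v"
      then show "u = v" using g[OF c_less[of v]]
        by (auto simp: f_def bij_betw_def dest: inj_onD)
    qed
    have img: "f ` verts G = {..<k} \<times> {..<2}"
    proof (intro equalityI subsetI)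
      fix p assume "p \<in> f ` verts G"
      then obtain v where v: "v \<in> verts G" "p = f v" by blast
      then have "g (c v) v \<in> {..<2}" using bij_betwE[OF g[OF c_less[of v]]] by blast
      with v c_less show "p \<in> {..<k} \<times> {..<2}" by (auto simp: f_def)
    next
      fix p assume "p \<in> {..<k} \<times> {..<2::nat}"
      then obtain i j where p: "p = (i, j)" "i < k" "j \<in> {..<2}" by auto
      then have "j \<in> g i ` {v \<in> verts G. c v = i}" using g[of i] by (simp add: bij_betw_def)
      with p show "p \<in> f ` verts G" by (auto simp: f_def)
    qed
    \<comment> \<open>To lie in \<open>with_proj ?K\<close>, each arc is renamed to the pair of
      images of its ends. This is injective because \<open>f\<close> is injective and
      \<open>G\<close> has no parallel arcs.\<close>
    define h where "h = \<lparr>iso_verts = f, iso_arcs = (\<lambda>e. (f (tail G e), f (head G e))),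
      iso_head = snd, iso_tail = fst\<rparr>"
    have h: "digraph_isomorphism h"
      unfolding digraph_isomorphism_def
    proof (intro conjI)
      show "inj_on (iso_arcs h) (arcs G)"
      proof (rule inj_onI)
        fix e e' assume e: "e \<in> arcs G" "e' \<in> arcs G" "iso_arcs h e = iso_arcs h e'"
        then have "arc_to_ends G e = arc_to_ends G e'"
          using inj by (auto simp: h_def arc_to_ends_def dest: inj_onD)
        with e show "e = e'" using no_multi_arcs by blast
      qed
    qed (use inj wf_digraph in \<open>auto simp: h_def\<close>)
    have "spanning (app_iso h G) (with_proj ?K)"
      unfolding spanning_def subgraph_def
    proof (intro conjI)
      show "wf_digraph (app_iso h G)" using h by (rule wf_digraphI_app_iso)
      show "wf_digraph (with_proj ?K)"
        by unfold_locales (auto simp: V A)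
      show "arcs (app_iso h G) \<subseteq> arcs (with_proj ?K)"
      proof
        fix a assume "a \<in> arcs (app_iso h G)"
        then obtain e where e: "e \<in> arcs G" "a = (f (tail G e), f (head G e))"
          by (auto simp: h_def)
        have "tail G e \<rightarrow>\<^bsub>G\<^esub> head G e" using e by (auto simp: arcs_ends_conv)
        then have "c (tail G e) \<noteq> c (head G e)" using c by (auto simp: proper_coloring_def)
        then have "fst (f (tail G e)) \<noteq> fst (f (head G e))" by (simp add: f_def)
        moreover have "f (tail G e) \<in> f ` verts G" "f (head G e) \<in> f ` verts G"
          using e(1) by simp_all
        ultimately show "a \<in> arcs (with_proj ?K)" unfolding img e(2) with_proj_simps A by blast
      qed
    qed (simp_all add: h_def img V compatible_def)
    with h show ?L by (auto simp: digraph_iso_def)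
  qed
qed

theorem theorem4:
  fixes G :: "('a, 'b) pre_digraph" and k :: nat
  assumes "k \<ge> 1"
    and "graph G"
    and "Digraph_Component.connected G"
  shows "(well_hued G \<and> hue_sequence G = map (\<lambda>j. 2 * j) [1..<Suc k] \<and> chromatic_number G = k)
    \<longleftrightarrow>
      ((\<exists>H. spanning H (with_proj (complete_multipartite (replicate k 2))) \<and> digraph_iso G H)
       \<and> (\<forall>u \<in> verts G. co_K2_free (G \<restriction> (verts G - closed_neighborhood G u))))"
proof -
  interpret graph G by fact
  show ?thesis
    using well_hued_iff_pair_coloring[OF assms(1)] spanning_complete_multipartite_iff[of k]
      co_K2_free_iff_independent_sets by simp
qed

end
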